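(* Let $p,z\in\mathbb{R}^n$ with $p^{\top}z\neq 0$ and let $\tau_{\min}\in\mathbb{R}$. Then $$\tau^{\mathrm{Dp}}:=\max\left\{\frac{p^{\top}z}{p^{\top}p},\ \tau_{\min}\right\}\qquad\text{and}\qquad \tau^{\mathrm{Dz}}:=\max\left\{\frac{z^{\top}z}{p^{\top}z},\ \tau_{\min}\right\}$$ are optimal scaling parameters resulting from a minimization of $|\xi u-v|$ subject to $\xi\ge\tau_{\min}$, where $(u,v)=(p,z)$ for (Dp) and $(u,v)=(z,p)$ for (Dz). Moreover, it holds that $|\tau^{\mathrm{Dp}}|\le|\tau^{\mathrm{Dz}}|$.
   Context: $|\cdot|$ denotes the Euclidean norm of a vector in $\mathbb{R}^n$ and the absolute value of a real number; the minimization is over the real variable $\xi$. The labels (Dp) and (Dz) refer to the parameters $\tau^{\mathrm{Dp}}$ and $\tau^{\mathrm{Dz}}$ respectively. Motivation: in a limited-memory BFGS method for an objective $J=D+S$ (data-fitting term $D$ plus regularizer $S$), the initial Hessian approximation is taken as $\tau I+A$, where $A$ is the symmetric positive semidefinite Hessian of $S$ at the current iterate. With $p$ the difference of successive iterates, $y$ the difference of the corresponding gradients of $J$, and $z:=y-Ap$, the secant equation $y=(\tau I+A)p$ is equivalent to $\tau p-z=0$. The scaling parameter $\tau$ is sought so that this equation holds in a least squares sense, subject to the lower bound $\tau\ge\tau_{\min}$.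
   Formalization: For (Dz), ξ is read as 1/τ with the bound 1/ξ ≥ τ_min (as written it fails: p=1, z=2, τ_min=0); constrained optimality is claimed only if p^T z>0 or τ_min ≤ z^T z/(2p^T z), where it holds; otherwise τ^Dz is only the truncated reciprocal of the unconstrained minimizer. *)

theory Defs
  imports "HOL-Analysis.Analysis"
begin

definition ls_solution :: "real ^ 'n \<Rightarrow> real ^ 'n \<Rightarrow> real set \<Rightarrow> real \<Rightarrow> bool" where
  "ls_solution u v C \<xi> \<longleftrightarrow> is_arg_min (\<lambda>t. norm (t *\<^sub>R u - v)) (\<lambda>t. t \<in> C) \<xi>"

definition tau_Dp :: "real ^ 'n \<Rightarrow> real ^ 'n \<Rightarrow> real \<Rightarrow> real" where
  "tau_Dp p z \<tau>min = max ((p \<bullet> z) / (p \<bullet> p)) \<tau>min"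

definition tau_Dz :: "real ^ 'n \<Rightarrow> real ^ 'n \<Rightarrow> real \<Rightarrow> real" where
  "tau_Dz p z \<tau>min = max ((z \<bullet> z) / (p \<bullet> z)) \<tau>min"

text \<open>
  For (Dp), the least squares variable is the scaling parameter itself, since the residual is
  that of \<open>\<tau> p - z = 0\<close>. For (Dz), the residual is that of the same equation divided by \<open>\<tau>\<close>,
  \<open>\<xi> z - p = 0\<close>, so the least squares variable is \<open>\<xi> = 1 / \<tau>\<close>. The lower bound always
  applies to the scaling parameter, so in terms of \<open>\<xi>\<close> it becomes \<open>\<tau>min \<le> 1 / \<xi>\<close>.
  The condition \<open>\<xi> \<noteq> 0\<close> is needed because \<open>1 / 0 = 0\<close>.

  Without the bound, the (Dz) solution is always \<open>1 / \<xi> = (z \<bullet> z) / (p \<bullet> z)\<close>. With the bound,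
  the truncated value \<open>tau_Dz\<close> is the constrained optimum if \<open>p \<bullet> z > 0\<close>. If \<open>p \<bullet> z < 0\<close>, the
  feasible set of \<open>\<xi>\<close> can also contain small positive numbers, and truncation stays optimal
  exactly as long as \<open>\<tau>min\<close> is at most half the unconstrained value.
\<close>

definition recip_feasible :: "real \<Rightarrow> real set" where
  "recip_feasible \<tau>min = {\<xi>. \<xi> \<noteq> 0 \<and> \<tau>min \<le> 1 / \<xi>}"

end

theory Submission
  imports Defs
begin

text \<open>
  For \<open>u \<noteq> 0\<close>, the squared residual \<open>\<bar>t u - v\<bar>\<^sup>2\<close> is a parabola in \<open>t\<close> with vertex at the
  projection coefficient \<open>(u \<bullet> v) / (u \<bullet> u)\<close>. Minimizing it over any set \<open>C\<close> of scalars therefore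
  means finding a point of \<open>C\<close> nearest to the vertex
  (\<open>ls_solution_if_nearest\<close>), and both optimality claims become questions about distances on the
  real line. For (Dp), the point of a half-line nearest to the vertex is given by truncation.

  For (Dz), the vertex is \<open>1 / b\<close> with \<open>b = (z \<bullet> z) / (p \<bullet> z)\<close>, and the feasible set is the
  preimage of a half-line under \<open>\<xi> \<mapsto> 1 / \<xi>\<close>. This preimage need not be an interval: for a
  negative bound it contains all positive numbers as well as a half-line of negative ones. If
  \<open>b < 0\<close> and truncation is active, the reciprocal of the truncated value is the boundary point of
  the negative branch. It has to be compared with the positive branch, whose distance from the
  vertex is \<open>\<bar>1 / b\<bar>\<close>; this is where the factor one half comes from (\<open>recip_truncation_nearest\<close>).

  Finally, by the Cauchy-Schwarz inequality the unconstrained parameters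
  \<open>a = (p \<bullet> z) / (p \<bullet> p)\<close> and \<open>b\<close> satisfy \<open>\<bar>a\<bar> \<le> \<bar>b\<bar>\<close>, and both have the sign of \<open>p \<bullet> z\<close>. Truncation from below keeps this
  ordering of absolute values: positive values stay positive and ordered, and negative values
  either stay negative and ordered or both become the same nonnegative bound.
\<close>

lemma norm_residual_square:
  fixes u v :: "'a::real_inner"
  assumes "u \<noteq> 0"
  shows "(norm (t *\<^sub>R u - v))\<^sup>2 =
    (u \<bullet> u) * (t - (u \<bullet> v) / (u \<bullet> u))\<^sup>2 + (v \<bullet> v - (u \<bullet> v)\<^sup>2 / (u \<bullet> u))"
proof -
  have "u \<bullet> u \<noteq> 0" using assms by simp
  then have "(u \<bullet> u) * (t - (u \<bullet> v) / (u \<bullet> u))\<^sup>2 + (v \<bullet> v - (u \<bullet> v)\<^sup>2 / (u \<bullet> u)) =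
      t\<^sup>2 * (u \<bullet> u) - 2 * t * (u \<bullet> v) + v \<bullet> v"
    by (simp add: power2_eq_square field_simps)
  moreover have "(norm (t *\<^sub>R u - v))\<^sup>2 = t\<^sup>2 * (u \<bullet> u) - 2 * t * (u \<bullet> v) + v \<bullet> v"
    unfolding power2_norm_eq_inner
    by (simp add: inner_diff inner_commute power2_eq_square algebra_simps)
  ultimately show ?thesis by simp
qed

lemma ls_solution_if_nearest:
  fixes u v :: "real ^ 'n"
  assumes "u \<noteq> 0" and "\<xi> \<in> C"
    and nearest: "\<And>t. t \<in> C \<Longrightarrow> \<bar>\<xi> - (u \<bullet> v) / (u \<bullet> u)\<bar> \<le> \<bar>t - (u \<bullet> v) / (u \<bullet> u)\<bar>"
  shows "ls_solution u v C \<xi>"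
proof -
  have "norm (\<xi> *\<^sub>R u - v) \<le> norm (t *\<^sub>R u - v)" if "t \<in> C" for t
  proof (rule power2_le_imp_le)
    have "(\<xi> - (u \<bullet> v) / (u \<bullet> u))\<^sup>2 \<le> (t - (u \<bullet> v) / (u \<bullet> u))\<^sup>2"
      using nearest[OF that] by (simp add: abs_le_square_iff)
    then show "(norm (\<xi> *\<^sub>R u - v))\<^sup>2 \<le> (norm (t *\<^sub>R u - v))\<^sup>2"
      unfolding norm_residual_square[OF assms(1)] by (simp add: mult_left_mono)
  qed simp
  then show ?thesis
    using assms(2) by (auto simp: ls_solution_def is_arg_min_linorder)
qed

text \<open>
  If the bound \<open>m\<close> exceeds \<open>b\<close>, the boundary point \<open>1 / m\<close> lies below the vertex \<open>1 / b\<close>. A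
  competitor \<open>t \<le> 1 / m\<close> is no nearer. The only other competitors are the positive
  numbers, which are feasible when \<open>m < 0\<close>; they are at distance more than \<open>- 1 / b\<close>, while the
  boundary point is at distance \<open>1 / b - 1 / m\<close>, and \<open>m \<le> b / 2 < 0\<close> says exactly that the
  latter is at most \<open>- 1 / b\<close>.
\<close>

lemma recip_truncation_nearest:
  fixes b m :: real
  assumes "b \<noteq> 0" and "b > 0 \<or> m \<le> b / 2"
  shows "1 / max b m \<in> recip_feasible m"
    and "t \<in> recip_feasible m \<Longrightarrow> \<bar>1 / max b m - 1 / b\<bar> \<le> \<bar>t - 1 / b\<bar>"
proof -
  have "max b m \<noteq> 0" using assms by linarith
  then show "1 / max b m \<in> recip_feasible m" by (simp add: recip_feasible_def)
  assume t: "t \<in> recip_feasible m"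
  show "\<bar>1 / max b m - 1 / b\<bar> \<le> \<bar>t - 1 / b\<bar>"
  proof (cases "m \<le> b")
    case True
    then show ?thesis by simp
  next
    case False
    then have bm: "b < m" "max b m = m" by auto
    have same_sign: "0 < m * b"
      using assms bm by (auto simp: zero_less_mult_iff)
    have below: "1 / m < 1 / b"
      using bm same_sign by (auto simp: field_simps zero_less_mult_iff)
    have t0: "t \<noteq> 0" "m \<le> 1 / t" using t by (auto simp: recip_feasible_def)
    consider "t \<le> 1 / m" | "m < 0" "0 < t"
    proof (cases "0 < t")
      case True
      then have "m * t \<le> 1" using t0 by (simp add: field_simps)
      then show thesis
        using that True same_sign
        by (cases "0 < m") (auto simp: field_simps zero_less_mult_iff)
    next
      case False
      then have "t < 0" using t0 by simp
      then have "1 \<le> m * t" using t0 by (simp add: field_simps)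
      then have "m < 0" using \<open>t < 0\<close> mult_nonneg_nonpos[of m t] by linarith
      then show thesis
        using that \<open>1 \<le> m * t\<close> by (simp add: neg_le_divide_eq mult.commute)
    qed
    then show ?thesis
    proof cases
      case 1
      then show ?thesis using below bm by simp
    next
      case 2
      then have "b < 0" and "m \<le> b / 2" using same_sign assms by (auto simp: zero_less_mult_iff)
      then have "2 / b \<le> 1 / m" using \<open>m < 0\<close> by (simp add: field_simps)
      moreover have "1 / b < 0" using \<open>b < 0\<close> by simp
      ultimately show ?thesis using 2 below bm by simp
    qed
  qed
qed

lemma abs_max_mono_same_sign:
  fixes a b m :: real
  assumes "\<bar>a\<bar> \<le> \<bar>b\<bar>" and "0 < a \<and> 0 < b \<or> a < 0 \<and> b < 0"
  shows "\<bar>max a m\<bar> \<le> \<bar>max b m\<bar>"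
  using assms by linarith

text \<open>
  Both optimal scalings carry the sign of \<open>x \<bullet> y\<close>, so after cross-multiplication the comparison
  of their absolute values is the Cauchy-Schwarz inequality.
\<close>

lemma abs_projection_coefficient_le:
  fixes x y :: "'a::real_inner"
  assumes "x \<bullet> y \<noteq> 0"
  shows "\<bar>(x \<bullet> y) / (x \<bullet> x)\<bar> \<le> \<bar>(y \<bullet> y) / (x \<bullet> y)\<bar>"
proof -
  have "0 < x \<bullet> x" using assms by auto
  moreover have "\<bar>x \<bullet> y\<bar> * \<bar>x \<bullet> y\<bar> \<le> (y \<bullet> y) * (x \<bullet> x)"
    using Cauchy_Schwarz_ineq[of x y] by (simp add: power2_eq_square mult.commute)
  ultimately show ?thesis
    using assms by (simp add: abs_divide divide_le_eq pos_le_divide_eq)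
qed

theorem lemma1:
  fixes p z :: "real ^ 'n" and \<tau>min :: real
  assumes "p \<bullet> z \<noteq> 0"
  shows "ls_solution p z {\<tau>min..} (tau_Dp p z \<tau>min)
       \<and> (\<exists>\<xi>. \<xi> \<noteq> 0 \<and> ls_solution z p UNIV \<xi> \<and> tau_Dz p z \<tau>min = max (1 / \<xi>) \<tau>min)
       \<and> (p \<bullet> z > 0 \<or> \<tau>min \<le> (z \<bullet> z) / (p \<bullet> z) / 2 \<longrightarrow>
            ls_solution z p (recip_feasible \<tau>min) (1 / tau_Dz p z \<tau>min))
       \<and> \<bar>tau_Dp p z \<tau>min\<bar> \<le> \<bar>tau_Dz p z \<tau>min\<bar>"
proof (intro conjI impI)
  define b where "b = (z \<bullet> z) / (p \<bullet> z)"
  have "p \<noteq> 0" "z \<noteq> 0" using assms by auto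
  then have pos: "0 < p \<bullet> p" "0 < z \<bullet> z" by simp_all
  have "b \<noteq> 0" using assms \<open>z \<noteq> 0\<close> by (simp add: b_def)
  have vertex: "(z \<bullet> p) / (z \<bullet> z) = 1 / b" by (simp add: b_def inner_commute)
  have tau_Dz: "tau_Dz p z \<tau>min = max b \<tau>min" by (simp add: tau_Dz_def b_def)

  show "ls_solution p z {\<tau>min..} (tau_Dp p z \<tau>min)"
    by (rule ls_solution_if_nearest) (use \<open>p \<noteq> 0\<close> in \<open>auto simp: tau_Dp_def\<close>)

  have "ls_solution z p UNIV (1 / b)"
    by (rule ls_solution_if_nearest) (use \<open>z \<noteq> 0\<close> vertex in auto)
  then show "\<exists>\<xi>. \<xi> \<noteq> 0 \<and> ls_solution z p UNIV \<xi> \<and> tau_Dz p z \<tau>min = max (1 / \<xi>) \<tau>min"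
    using \<open>b \<noteq> 0\<close> tau_Dz by (intro exI[of _ "1 / b"]) simp

  show "ls_solution z p (recip_feasible \<tau>min) (1 / tau_Dz p z \<tau>min)"
    if "p \<bullet> z > 0 \<or> \<tau>min \<le> (z \<bullet> z) / (p \<bullet> z) / 2"
  proof -
    have "b > 0 \<or> \<tau>min \<le> b / 2" using that pos by (auto simp: b_def)
    note nearest = recip_truncation_nearest[OF \<open>b \<noteq> 0\<close> this]
    show ?thesis
      unfolding tau_Dz
      by (rule ls_solution_if_nearest) (use \<open>z \<noteq> 0\<close> nearest vertex in auto)
  qed

  show "\<bar>tau_Dp p z \<tau>min\<bar> \<le> \<bar>tau_Dz p z \<tau>min\<bar>"
    unfolding tau_Dp_def tau_Dz_def
  proof (rule abs_max_mono_same_sign)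
    show "\<bar>(p \<bullet> z) / (p \<bullet> p)\<bar> \<le> \<bar>(z \<bullet> z) / (p \<bullet> z)\<bar>"
      using abs_projection_coefficient_le[OF assms] .
    show "0 < (p \<bullet> z) / (p \<bullet> p) \<and> 0 < (z \<bullet> z) / (p \<bullet> z)
        \<or> (p \<bullet> z) / (p \<bullet> p) < 0 \<and> (z \<bullet> z) / (p \<bullet> z) < 0"
      using assms pos by (auto simp: zero_less_divide_iff divide_less_0_iff linorder_neq_iff)
  qed
qed

end
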